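(* Let $n\ge1$, $x_1,\dots,x_n$ variables and $\lambda$ a partition. Then $j_\lambda(x_1,\dots,x_n)=Z_\lambda=Z^*_\lambda$, where: $Z_\lambda$ is the partition function of $n$ rows with horizontal labels in $\{0,1\}$, row $k$ (from the bottom) having parameter $x_k$, bottom boundary all $0$, top boundary $(m^c_j(\lambda))_{j\ge1}$, right boundary value $0$, free left boundary, and weights (for $m\ge0$ unless stated): $w_x(0,m;0,m)=1$; $w_x(0,m;1,m-1)=1$ ($m\ge1$); $w_x(1,m;0,m+1)=x$; $w_x(1,m;1,m)=x$ ($m\ge1$); $w_x(1,0;1,0)=x+1$; all other weights $0$; $Z^*_\lambda$ is the partition function of $n$ rows with horizontal labels in $\{0,1\}$, row $k$ (from the bottom) having parameter $x_{n+1-k}$, bottom boundary $(m^c_j(\lambda))_{j\ge1}$, top boundary all $0$, right boundary value $1$, free left boundary, and weights: $w^*_x(1,m;1,m)=1$; $w^*_x(1,m;0,m+1)=1$; $w^*_x(0,m;1,m-1)=x$ ($m\ge1$); $w^*_x(0,m;0,m)=x$ ($m\ge1$); $w^*_x(0,0;0,0)=x+1$; all other weights $0$.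
   Context: Notation $w_x(a,b;c,d)$: weight of a vertex with left label $a$, bottom label $b$, right label $c$, top label $d$. Dual Grothendieck polynomials: for $\mu\subseteq\lambda$ let $r,c,b$ be the numbers of nonempty rows, nonempty columns and edge-connected components of $\lambda/\mu$; $g^{(\alpha,\beta)}_\lambda()=\delta_{\lambda,\emptyset}$ and $g^{(\alpha,\beta)}_\lambda(x_1,\dots,x_{n+1})=\sum_{\mu\subseteq\lambda}g^{(\alpha,\beta)}_\mu(x_1,\dots,x_n)\beta^{r-b}(\alpha+\beta)^{|\lambda|-|\mu|-r-c+b}x_{n+1}^{b}(\alpha+x_{n+1})^{c-b}$. The weak dual Grothendieck polynomial is $j_\lambda=g^{(1,0)}_{\lambda'}$ ($\lambda'$ the conjugate partition, $0^0=1$). Lattice conventions. A row with parameter $x$ is a sequence of vertices at sites $j=1,2,\dots$, the right label at site $j$ being the left label at site $j+1$; vertical labels are nonnegative integers; the left label at site 1 is free and the right labels must be eventually equal to the prescribed right boundary value. Rows are stacked bottom to top, top labels of a row = bottom labels of the next; the bottom labels of the lowest row and top labels of the highest row are prescribed. Partition function: sum over labelings of non-prescribed edges of the product of vertex weights. $m^c_j(\lambda)=\lambda_j-\lambda_{j+1}$. *)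

theory Defs
  imports Main "HOL-Library.FuncSet"
begin

text \<open>All indices start at \<open>0\<close>: \<open>lam i\<close> is the part \<open>\<lambda>\<^bsub>i+1\<^esub>\<close>, \<open>x k\<close> is the variable \<open>x\<^bsub>k+1\<^esub>\<close>,
  site \<open>j\<close> of a row is the site \<open>j + 1\<close> of the lattice, and row \<open>k\<close> is the \<open>(k+1)\<close>-st row
  from the bottom.\<close>

definition is_partition :: "(nat \<Rightarrow> nat) \<Rightarrow> bool" where
  "is_partition lam \<longleftrightarrow> antimono lam \<and> finite {i. lam i \<noteq> 0}"

definition psize :: "(nat \<Rightarrow> nat) \<Rightarrow> nat" where
  "psize lam = (\<Sum>i | lam i \<noteq> 0. lam i)"

definition conjugate :: "(nat \<Rightarrow> nat) \<Rightarrow> nat \<Rightarrow> nat" where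
  "conjugate lam j = card {i. j < lam i}"

definition skew_diagram :: "(nat \<Rightarrow> nat) \<Rightarrow> (nat \<Rightarrow> nat) \<Rightarrow> (nat \<times> nat) set" where
  "skew_diagram lam mu = {(i, j). mu i \<le> j \<and> j < lam i}"

definition edge_adjacent :: "((nat \<times> nat) \<times> (nat \<times> nat)) set" where
  "edge_adjacent = {((i, j), (i', j')).
     (i = i' \<and> (j' = Suc j \<or> j = Suc j')) \<or> (j = j' \<and> (i' = Suc i \<or> i = Suc i'))}"

definition edge_components :: "(nat \<times> nat) set \<Rightarrow> (nat \<times> nat) set set" where
  "edge_components D = D // (edge_adjacent \<inter> D \<times> D)\<^sup>*"

definition skew_rows :: "(nat \<Rightarrow> nat) \<Rightarrow> (nat \<Rightarrow> nat) \<Rightarrow> nat" where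
  "skew_rows lam mu = card (fst ` skew_diagram lam mu)"

definition skew_cols :: "(nat \<Rightarrow> nat) \<Rightarrow> (nat \<Rightarrow> nat) \<Rightarrow> nat" where
  "skew_cols lam mu = card (snd ` skew_diagram lam mu)"

definition skew_comps :: "(nat \<Rightarrow> nat) \<Rightarrow> (nat \<Rightarrow> nat) \<Rightarrow> nat" where
  "skew_comps lam mu = card (edge_components (skew_diagram lam mu))"

text \<open>The subtractions of natural numbers in the exponents never truncate: a connected skew
  shape with \<open>r\<close> rows and \<open>c\<close> columns has \<open>r, c \<ge> 1\<close> and at least \<open>r + c - 1\<close> cells, and
  distinct components of a skew shape share neither rows nor columns.\<close>

primrec dual_groth ::
    "'a::comm_ring_1 \<Rightarrow> 'a \<Rightarrow> (nat \<Rightarrow> 'a) \<Rightarrow> nat \<Rightarrow> (nat \<Rightarrow> nat) \<Rightarrow> 'a" where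
  "dual_groth \<alpha> \<beta> x 0 lam = (if lam = (\<lambda>_. 0) then 1 else 0)"
| "dual_groth \<alpha> \<beta> x (Suc n) lam =
     (\<Sum>mu | is_partition mu \<and> (\<forall>i. mu i \<le> lam i).
        let r = skew_rows lam mu; c = skew_cols lam mu; b = skew_comps lam mu
        in dual_groth \<alpha> \<beta> x n mu * \<beta> ^ (r - b)
             * (\<alpha> + \<beta>) ^ (psize lam + b - (psize mu + r + c))
             * x n ^ b * (\<alpha> + x n) ^ (c - b))"

definition weak_dual_groth :: "(nat \<Rightarrow> 'a::comm_ring_1) \<Rightarrow> nat \<Rightarrow> (nat \<Rightarrow> nat) \<Rightarrow> 'a" where
  "weak_dual_groth x n lam = dual_groth 1 0 x n (conjugate lam)"

definition mc :: "(nat \<Rightarrow> nat) \<Rightarrow> nat \<Rightarrow> nat" where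
  "mc lam j = lam j - lam (Suc j)"

text \<open>A labeling of \<open>n\<close> rows is a pair \<open>(v, h)\<close>. The vertex at site \<open>j\<close> of row \<open>k < n\<close> has left
  label \<open>h k j\<close>, bottom label \<open>v k j\<close>, right label \<open>h k (Suc j)\<close> and top label \<open>v (Suc k) j\<close>.
  Extensionality only makes labelings of the same edges equal as functions.\<close>

definition labelings ::
    "nat \<Rightarrow> (nat \<Rightarrow> nat) \<Rightarrow> (nat \<Rightarrow> nat) \<Rightarrow> nat \<Rightarrow> ((nat \<Rightarrow> nat \<Rightarrow> nat) \<times> (nat \<Rightarrow> nat \<Rightarrow> nat)) set" where
  "labelings n lower upper right =
     {(v, h). v \<in> extensional {..n} \<and> h \<in> extensional {..<n} \<and> v 0 = lower \<and> v n = upper \<and>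
        (\<forall>k<n. (\<forall>j. h k j \<in> {0, 1}) \<and> (\<exists>N. \<forall>j\<ge>N. h k j = right))}"

text \<open>Product of the vertex weights of a row over infinitely many sites. In both models below, far
  enough to the right all horizontal labels equal the boundary value and every vertex weight is
  \<open>0\<close> or \<open>1\<close>; so if infinitely many weights differ from \<open>1\<close>, there is a factor \<open>0\<close>.\<close>

definition site_prod :: "(nat \<Rightarrow> 'a::comm_ring_1) \<Rightarrow> 'a" where
  "site_prod f = (if finite {j. f j \<noteq> 1} then \<Prod>j | f j \<noteq> 1. f j else 0)"

text \<open>Vertex weights take their arguments in the order: parameter, left, bottom, right, top.\<close>

type_synonym 'a vertex_weight = "'a \<Rightarrow> nat \<Rightarrow> nat \<Rightarrow> nat \<Rightarrow> nat \<Rightarrow> 'a"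

definition labeling_weight ::
    "'a::comm_ring_1 vertex_weight \<Rightarrow> (nat \<Rightarrow> 'a) \<Rightarrow> nat \<Rightarrow>
     (nat \<Rightarrow> nat \<Rightarrow> nat) \<times> (nat \<Rightarrow> nat \<Rightarrow> nat) \<Rightarrow> 'a" where
  "labeling_weight w y n = (\<lambda>(v, h).
     \<Prod>k<n. site_prod (\<lambda>j. w (y k) (h k j) (v k j) (h k (Suc j)) (v (Suc k) j)))"

text \<open>In both models below, for finitely supported \<open>lower\<close> and \<open>upper\<close>, only finitely many labelings
  have nonzero weight, so summing over these gives the sum over all labelings.\<close>

definition partition_function ::
    "'a::comm_ring_1 vertex_weight \<Rightarrow> (nat \<Rightarrow> 'a) \<Rightarrow> nat \<Rightarrow>
     (nat \<Rightarrow> nat) \<Rightarrow> (nat \<Rightarrow> nat) \<Rightarrow> nat \<Rightarrow> 'a" where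
  "partition_function w y n lower upper right =
     (\<Sum>L \<in> {L \<in> labelings n lower upper right. labeling_weight w y n L \<noteq> 0}. labeling_weight w y n L)"

definition wt :: "'a::comm_ring_1 vertex_weight" where
  "wt x a b c d =
     (if a = 0 \<and> c = 0 \<and> d = b then 1
      else if a = 0 \<and> c = 1 \<and> b \<ge> 1 \<and> d = b - 1 then 1
      else if a = 1 \<and> c = 0 \<and> d = b + 1 then x
      else if a = 1 \<and> c = 1 \<and> b \<ge> 1 \<and> d = b then x
      else if a = 1 \<and> c = 1 \<and> b = 0 \<and> d = 0 then x + 1
      else 0)"

definition wt_star :: "'a::comm_ring_1 vertex_weight" where
  "wt_star x a b c d =
     (if a = 1 \<and> c = 1 \<and> d = b then 1
      else if a = 1 \<and> c = 0 \<and> d = b + 1 then 1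
      else if a = 0 \<and> c = 1 \<and> b \<ge> 1 \<and> d = b - 1 then x
      else if a = 0 \<and> c = 0 \<and> b \<ge> 1 \<and> d = b then x
      else if a = 0 \<and> c = 0 \<and> b = 0 \<and> d = 0 then x + 1
      else 0)"

definition Z :: "(nat \<Rightarrow> 'a::comm_ring_1) \<Rightarrow> nat \<Rightarrow> (nat \<Rightarrow> nat) \<Rightarrow> 'a" where
  "Z x n lam = partition_function wt x n (\<lambda>_. 0) (mc lam) 0"

definition Z_star :: "(nat \<Rightarrow> 'a::comm_ring_1) \<Rightarrow> nat \<Rightarrow> (nat \<Rightarrow> nat) \<Rightarrow> 'a" where
  "Z_star x n lam = partition_function wt_star (\<lambda>k. x (n - 1 - k)) n (mc lam) (\<lambda>_. 0) 1"

end

theory Submission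
  imports Defs
begin

text \<open>For \<open>\<alpha> = 1\<close>, \<open>\<beta> = 0\<close> only the terms with as many components as rows survive in the branching
  rule of the dual Grothendieck polynomials, that is, horizontal strips; after conjugation \<open>\<lambda>/\<mu>\<close> is a
  vertical strip, of weight \<open>x\<^sup>k (1 + x)\<^bsup>s - k\<^esup>\<close> with \<open>k\<close> the number of columns and \<open>s\<close> the number of
  cells. A vertex of nonzero weight \<open>w\<^sub>x(a, b; c, d)\<close> satisfies \<open>a + b = c + d\<close>, so a lattice row
  with bottom \<open>m\<^sup>c(\<mu>)\<close> and top \<open>m\<^sup>c(\<lambda>)\<close> has the horizontal labels \<open>\<lambda>\<^sub>j - \<mu>\<^sub>j\<close>, and its weight is
  the weight of the strip; hence both sides obey the same recursion on the number of rows. The second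
  model is the first one turned upside down, with horizontal labels \<open>0\<close> and \<open>1\<close> exchanged.\<close>

section \<open>Partitions and conjugation\<close>

lemma is_partition_antimono: "is_partition lam \<Longrightarrow> i \<le> j \<Longrightarrow> lam j \<le> lam i"
  by (simp add: is_partition_def antimono_def)

lemma is_partition_eventually_zero:
  assumes "is_partition lam"
  shows "\<exists>N. \<forall>j\<ge>N. lam j = 0"
proof -
  from assms have "finite {i. lam i \<noteq> 0}" by (simp add: is_partition_def)
  then obtain N where "\<forall>i\<in>{i. lam i \<noteq> 0}. i < N"
    using finite_nat_set_iff_bounded by blast
  then have "\<forall>j\<ge>N. lam j = 0" by (auto simp: not_less[symmetric])
  then show ?thesis ..
qed

lemma is_partitionI:
  assumes "\<And>i. lam (Suc i) \<le> lam i" and "\<And>j. j \<ge> N \<Longrightarrow> lam j = 0"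
  shows "is_partition lam"
proof -
  have "{i. lam i \<noteq> 0} \<subseteq> {..<N}" using assms(2) not_less by auto
  then have "finite {i. lam i \<noteq> 0}" by (rule finite_subset) simp
  moreover have "antimono lam" using assms(1) by (simp add: antimono_iff_le_Suc)
  ultimately show ?thesis by (simp add: is_partition_def)
qed

text \<open>Both sides say that row \<open>j\<close> has a cell in column \<open>i\<close>: as
  \<open>lam\<close> decreases, the rows meeting that column form an initial segment
  \<open>{..<m}\<close>. The lemmas on conjugation below rest on this equivalence.\<close>

lemma less_conjugate_iff:
  assumes "is_partition lam"
  shows "j < conjugate lam i \<longleftrightarrow> i < lam j"
proof -
  obtain N where N: "\<forall>j\<ge>N. lam j = 0" using is_partition_eventually_zero[OF assms] ..
  define m where "m = (LEAST m. lam m \<le> i)"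
  have m: "lam m \<le> i" unfolding m_def by (rule LeastI[of _ N]) (simp add: N)
  have "{j. i < lam j} = {..<m}"
  proof (intro equalityI subsetI)
    fix j assume "j \<in> {j. i < lam j}"
    then show "j \<in> {..<m}"
      using m is_partition_antimono[OF assms, of m j] by (auto simp: not_less[symmetric])
  next
    fix j assume "j \<in> {..<m}"
    then show "j \<in> {j. i < lam j}" using not_less_Least[of j "\<lambda>m. lam m \<le> i"] by (auto simp: m_def)
  qed
  then have "j < conjugate lam i \<longleftrightarrow> j \<in> {j. i < lam j}" by (simp add: conjugate_def)
  then show ?thesis by simp
qed

lemma conjugate_le_iff: "is_partition lam \<Longrightarrow> conjugate lam i \<le> j \<longleftrightarrow> lam j \<le> i"
  using less_conjugate_iff[of lam j i] by linarith

lemma is_partition_conjugate: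
  assumes "is_partition lam"
  shows "is_partition (conjugate lam)"
proof (rule is_partitionI[where N = "lam 0"])
  show "conjugate lam (Suc i) \<le> conjugate lam i" for i
    using conjugate_le_iff[OF assms, of i "conjugate lam i"]
    by (simp add: conjugate_le_iff[OF assms])
  show "conjugate lam j = 0" if "lam 0 \<le> j" for j
    using conjugate_le_iff[OF assms, of j 0] that by simp
qed

lemma conjugate_conjugate:
  assumes "is_partition lam"
  shows "conjugate (conjugate lam) = lam"
proof
  fix i
  have "j < conjugate (conjugate lam) i \<longleftrightarrow> j < lam i" for j
    by (simp add: less_conjugate_iff assms is_partition_conjugate)
  then show "conjugate (conjugate lam) i = lam i" by (metis linorder_neqE_nat less_irrefl)
qed

lemma conjugate_mono:
  assumes "is_partition mu" "is_partition lam" "\<forall>i. mu i \<le> lam i"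
  shows "conjugate mu i \<le> conjugate lam i"
proof -
  have "lam (conjugate lam i) \<le> i" using conjugate_le_iff[OF assms(2), of i "conjugate lam i"] by simp
  then show ?thesis using assms(3) by (simp add: conjugate_le_iff[OF assms(1)]) (meson le_trans)
qed

lemma finite_subpartitions:
  assumes "is_partition lam"
  shows "finite {mu. is_partition mu \<and> (\<forall>i. mu i \<le> lam i)}"
proof (rule finite_subset)
  show "{mu. is_partition mu \<and> (\<forall>i. mu i \<le> lam i)} \<subseteq>
     {mu. \<forall>i. (i \<in> {i. lam i \<noteq> 0} \<longrightarrow> mu i \<in> {..lam 0}) \<and> (i \<notin> {i. lam i \<noteq> 0} \<longrightarrow> mu i = 0)}"
    using is_partition_antimono[OF assms, of 0] by (auto intro: le_trans) (metis le_zero_eq)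
  show "finite \<dots>"
    using assms by (intro finite_set_of_finite_funs) (auto simp: is_partition_def)
qed

lemma skew_diagram_conjugate:
  assumes "is_partition lam" "is_partition mu"
  shows "skew_diagram (conjugate lam) (conjugate mu) = (skew_diagram lam mu)\<inverse>"
  by (auto simp: skew_diagram_def less_conjugate_iff conjugate_le_iff assms)

section \<open>Components of a skew diagram\<close>

lemma row_connected:
  assumes "D = skew_diagram lam mu" and "mu i \<le> j" "j < lam i"
  shows "((i, mu i), (i, j)) \<in> (edge_adjacent \<inter> D \<times> D)\<^sup>*"
  using assms(2,3)
proof (induction j rule: dec_induct)
  case (step j)
  then have "((i, j), (i, Suc j)) \<in> edge_adjacent \<inter> D \<times> D"
    using assms(1) by (auto simp: edge_adjacent_def skew_diagram_def)
  then show ?case using step by (meson Suc_lessD rtrancl.rtrancl_into_rtrancl)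
qed simp

lemma sym_edge_rtrancl: "sym ((edge_adjacent \<inter> D \<times> D)\<^sup>*)"
  by (rule sym_rtrancl) (auto simp: sym_def edge_adjacent_def)

lemma edge_rtrancl_class_eq_iff:
  "(edge_adjacent \<inter> D \<times> D)\<^sup>* `` {p} = (edge_adjacent \<inter> D \<times> D)\<^sup>* `` {q} \<longleftrightarrow>
   (p, q) \<in> (edge_adjacent \<inter> D \<times> D)\<^sup>*" (is "?R `` _ = _ \<longleftrightarrow> _")
proof
  assume "?R `` {p} = ?R `` {q}"
  then show "(p, q) \<in> ?R" by blast
next
  assume pq: "(p, q) \<in> ?R"
  then have "(q, p) \<in> ?R" using sym_edge_rtrancl by (rule symD[rotated])
  with pq show "?R `` {p} = ?R `` {q}" by (blast intro: rtrancl_trans)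
qed

text \<open>Each row of a skew shape is connected, so its leftmost cell \<open>(i, mu i)\<close>
  represents its component. Components are thus an image of the nonempty rows, and counting them
  becomes a question of injectivity.\<close>

lemma edge_components_skew_diagram:
  assumes "D = skew_diagram lam mu"
  shows "edge_components D = (\<lambda>i. (edge_adjacent \<inter> D \<times> D)\<^sup>* `` {(i, mu i)}) ` fst ` D"
proof -
  have "(edge_adjacent \<inter> D \<times> D)\<^sup>* `` {p} = (edge_adjacent \<inter> D \<times> D)\<^sup>* `` {(fst p, mu (fst p))}"
    if "p \<in> D" for p
  proof -
    have "((fst p, mu (fst p)), p) \<in> (edge_adjacent \<inter> D \<times> D)\<^sup>*"
      using row_connected[OF assms, of "fst p" "snd p"] that assms
      by (auto simp: skew_diagram_def)
    then show ?thesis using edge_rtrancl_class_eq_iff by blast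
  qed
  then show ?thesis by (auto simp: edge_components_def quotient_def image_iff)
qed

lemma finite_skew_diagram:
  assumes "is_partition lam"
  shows "finite (skew_diagram lam mu)"
proof (rule finite_subset)
  show "skew_diagram lam mu \<subseteq> (SIGMA i:{i. lam i \<noteq> 0}. {..<lam i})"
    by (auto simp: skew_diagram_def)
  show "finite \<dots>" using assms by (auto simp: is_partition_def)
qed

text \<open>Without vertically adjacent cells a path never leaves its row, so distinct rows lie in
  distinct components.\<close>

lemma skew_comps_eq_skew_rows:
  assumes "\<And>i j. (i, j) \<in> skew_diagram lam mu \<Longrightarrow> (Suc i, j) \<notin> skew_diagram lam mu"
  shows "skew_comps lam mu = skew_rows lam mu"
proof -
  define D where D: "D = skew_diagram lam mu"
  have same_row: "fst p = fst q" if "(p, q) \<in> (edge_adjacent \<inter> D \<times> D)\<^sup>*" for p q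
    using that
  proof (induction rule: rtrancl_induct)
    case (step q s)
    have "fst q = fst s"
      using step(2) assms unfolding D[symmetric] edge_adjacent_def by auto
    then show ?case using step by simp
  qed simp
  have "inj_on (\<lambda>i. (edge_adjacent \<inter> D \<times> D)\<^sup>* `` {(i, mu i)}) (fst ` D)"
    by (rule inj_onI) (use same_row edge_rtrancl_class_eq_iff in fastforce)
  then show ?thesis
    using edge_components_skew_diagram[OF D]
    by (simp add: skew_comps_def skew_rows_def D[symmetric] card_image)
qed

text \<open>A vertical domino puts rows \<open>i\<close> and \<open>Suc i\<close> into one
  component, so the map from rows to components is not injective. For \<open>beta = 0\<close> this
  kills the factor \<open>beta ^ (r - b)\<close>.\<close>

lemma skew_comps_less_skew_rows:
  assumes "is_partition lam" "(i, j) \<in> skew_diagram lam mu" "(Suc i, j) \<in> skew_diagram lam mu"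
  shows "skew_comps lam mu < skew_rows lam mu"
proof -
  define D where D: "D = skew_diagram lam mu"
  define C where "C = (\<lambda>i. (edge_adjacent \<inter> D \<times> D)\<^sup>* `` {(i, mu i)})"
  have fin: "finite (fst ` D)" using finite_skew_diagram[OF assms(1)] D by simp
  have mem: "i \<in> fst ` D" "Suc i \<in> fst ` D" using assms(2,3) unfolding D by force+
  have "((i, mu i), (i, j)) \<in> (edge_adjacent \<inter> D \<times> D)\<^sup>*"
    "((Suc i, mu (Suc i)), (Suc i, j)) \<in> (edge_adjacent \<inter> D \<times> D)\<^sup>*"
    using assms(2,3) row_connected[OF D] by (auto simp: skew_diagram_def)
  moreover have "((i, j), (Suc i, j)) \<in> (edge_adjacent \<inter> D \<times> D)\<^sup>*"
    using assms(2,3) by (intro r_into_rtrancl) (auto simp: edge_adjacent_def D)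
  ultimately have "((i, mu i), (Suc i, mu (Suc i))) \<in> (edge_adjacent \<inter> D \<times> D)\<^sup>*"
    using sym_edge_rtrancl[of D] by (meson rtrancl_trans symD)
  then have "C i = C (Suc i)" unfolding C_def using edge_rtrancl_class_eq_iff by blast
  then have "\<not> inj_on C (fst ` D)" using mem by (auto dest: inj_onD)
  then have "card (C ` fst ` D) < card (fst ` D)"
    using fin by (metis card_image_le eq_card_imp_inj_on le_neq_implies_less)
  then show ?thesis
    using edge_components_skew_diagram[OF D]
    by (simp add: skew_comps_def skew_rows_def D[symmetric] C_def)
qed

section \<open>The branching rule\<close>

definition vertical_strip_below :: "(nat \<Rightarrow> nat) \<Rightarrow> (nat \<Rightarrow> nat) set" where
  "vertical_strip_below lam = {mu. is_partition mu \<and> (\<forall>i. mu i \<le> lam i \<and> lam i \<le> Suc (mu i))}"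

text \<open>In a vertical strip the only cell of a nonempty row \<open>j\<close> lies in column
  \<open>mu j\<close>, so \<open>{j. lam j \<noteq> mu j}\<close> counts the cells and its image
  under \<open>mu\<close> counts the columns.\<close>

definition strip_weight :: "'a::comm_ring_1 \<Rightarrow> (nat \<Rightarrow> nat) \<Rightarrow> (nat \<Rightarrow> nat) \<Rightarrow> 'a" where
  "strip_weight x lam mu =
     x ^ card (mu ` {j. lam j \<noteq> mu j})
     * (1 + x) ^ (card {j. lam j \<noteq> mu j} - card (mu ` {j. lam j \<noteq> mu j}))"

lemma finite_vertical_strip_below:
  "is_partition lam \<Longrightarrow> finite (vertical_strip_below lam)"
  by (rule finite_subset[OF _ finite_subpartitions[of lam]]) (auto simp: vertical_strip_below_def)

lemma finite_skew_support:
  assumes "is_partition lam" "\<forall>i. mu i \<le> lam i"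
  shows "finite {j. lam j \<noteq> mu j}"
proof (rule finite_subset)
  show "{j. lam j \<noteq> mu j} \<subseteq> {j. lam j \<noteq> 0}" 
    using assms(2) by (metis (mono_tags, lifting) Collect_mono le_zero_eq)
  show "finite {j. lam j \<noteq> 0}" using assms(1) by (simp add: is_partition_def)
qed

lemma weak_dual_groth_Suc:
  assumes lam: "is_partition lam"
  shows "weak_dual_groth x (Suc n) lam =
    (\<Sum>mu\<in>vertical_strip_below lam. weak_dual_groth x n mu * strip_weight (x n) lam mu)"
proof -
  define S where "S = {mu. is_partition mu \<and> (\<forall>i. mu i \<le> lam i)}"
  define F where "F = (\<lambda>mu. let r = skew_rows (conjugate lam) mu; c = skew_cols (conjugate lam) mu;
      b = skew_comps (conjugate lam) mu
    in dual_groth 1 0 x n mu * 0 ^ (r - b)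
         * (1 + 0) ^ (psize (conjugate lam) + b - (psize mu + r + c)) * x n ^ b * (1 + x n) ^ (c - b))"
  \<comment> \<open>Conjugation is an inclusion-preserving involution on partitions; it moves the
    branching sum from below \<open>conjugate lam\<close> to below \<open>lam\<close>.\<close>
  have bij: "bij_betw conjugate S {mu. is_partition mu \<and> (\<forall>i. mu i \<le> conjugate lam i)}"
  proof (rule bij_betwI[where g = conjugate])
    show "conjugate \<in> S \<rightarrow> {mu. is_partition mu \<and> (\<forall>i. mu i \<le> conjugate lam i)}"
      using conjugate_mono[OF _ lam] is_partition_conjugate by (auto simp: S_def)
    show "conjugate \<in> {mu. is_partition mu \<and> (\<forall>i. mu i \<le> conjugate lam i)} \<rightarrow> S"
      using conjugate_mono[OF _ is_partition_conjugate[OF lam]] is_partition_conjugate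
      by (auto simp: S_def conjugate_conjugate[OF lam])
  qed (auto simp: S_def conjugate_conjugate)
  have rows: "skew_rows (conjugate lam) (conjugate mu) = card (snd ` skew_diagram lam mu)"
    and cols: "skew_cols (conjugate lam) (conjugate mu) = card (fst ` skew_diagram lam mu)"
    if "is_partition mu" for mu
    by (auto simp: skew_rows_def skew_cols_def skew_diagram_conjugate[OF lam that] image_iff
      intro!: arg_cong[where f = card]) force+
  have strip: "F (conjugate mu) = weak_dual_groth x n mu * strip_weight (x n) lam mu"
    if mu: "mu \<in> vertical_strip_below lam" for mu
  proof -
    have pmu: "is_partition mu" and le: "mu j \<le> lam j" "lam j \<le> Suc (mu j)" for j
      using mu by (auto simp: vertical_strip_below_def)
    have D: "skew_diagram lam mu = (\<lambda>j. (j, mu j)) ` {j. lam j \<noteq> mu j}"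
    proof (intro equalityI subsetI)
      fix p assume "p \<in> skew_diagram lam mu"
      then show "p \<in> (\<lambda>j. (j, mu j)) ` {j. lam j \<noteq> mu j}"
        using le(2)[of "fst p"] by (cases p) (auto simp: skew_diagram_def)
    next
      fix p assume "p \<in> (\<lambda>j. (j, mu j)) ` {j. lam j \<noteq> mu j}"
      then show "p \<in> skew_diagram lam mu"
        using le(1)[of "fst p"] by (auto simp: skew_diagram_def)
    qed
    \<comment> \<open>The cells of the conjugate shape are the pairs \<open>(mu j, j)\<close>, one
      per column, so no two are vertically adjacent.\<close>
    have comps: "skew_comps (conjugate lam) (conjugate mu) = skew_rows (conjugate lam) (conjugate mu)"
      by (rule skew_comps_eq_skew_rows) (auto simp: skew_diagram_conjugate[OF lam pmu] D)
    have "fst ` skew_diagram lam mu = {j. lam j \<noteq> mu j}"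
      "snd ` skew_diagram lam mu = mu ` {j. lam j \<noteq> mu j}"
      unfolding D by (auto simp: image_iff)
    then show ?thesis
      by (simp add: F_def Let_def comps rows[OF pmu] cols[OF pmu] strip_weight_def
        weak_dual_groth_def mult.assoc)
  qed
  have zero: "F (conjugate mu) = 0" if mu: "mu \<in> S - vertical_strip_below lam" for mu
  proof -
    have pmu: "is_partition mu" using mu by (simp add: S_def)
    \<comment> \<open>Row \<open>j\<close> has cells in columns \<open>mu j\<close> and
      \<open>Suc (mu j)\<close>; conjugation turns them into a vertical domino.\<close>
    obtain j where j: "Suc (mu j) < lam j"
      using mu unfolding S_def vertical_strip_below_def by (auto simp: not_less[symmetric])
    have "skew_comps (conjugate lam) (conjugate mu) < skew_rows (conjugate lam) (conjugate mu)"
      by (rule skew_comps_less_skew_rows[OF is_partition_conjugate[OF lam], of "mu j" j])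
        (use j in \<open>auto simp: skew_diagram_def less_conjugate_iff conjugate_le_iff lam pmu\<close>)
    then show ?thesis by (simp add: F_def Let_def power_0_left)
  qed
  have "weak_dual_groth x (Suc n) lam = sum F {mu. is_partition mu \<and> (\<forall>i. mu i \<le> conjugate lam i)}"
    by (simp add: weak_dual_groth_def F_def)
  also have "\<dots> = (\<Sum>mu\<in>S. F (conjugate mu))"
    by (rule sum.reindex_bij_betw[OF bij, symmetric])
  also have "\<dots> = (\<Sum>mu\<in>vertical_strip_below lam. F (conjugate mu))"
    by (rule sum.mono_neutral_right)
      (use zero in \<open>auto simp: S_def vertical_strip_below_def finite_subpartitions[OF lam]\<close>)
  also have "\<dots> = (\<Sum>mu\<in>vertical_strip_below lam. weak_dual_groth x n mu * strip_weight (x n) lam mu)"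
    by (rule sum.cong) (simp_all add: strip)
  finally show ?thesis .
qed

section \<open>The row-to-row weight\<close>

lemma site_prod_eq_prod:
  assumes "finite A" "\<And>j. j \<notin> A \<Longrightarrow> f j = 1"
  shows "site_prod f = prod f A"
proof -
  have sub: "{j. f j \<noteq> 1} \<subseteq> A" using assms(2) by auto
  then have "finite {j. f j \<noteq> 1}" using assms(1) finite_subset by blast
  moreover have "prod f {j. f j \<noteq> 1} = prod f A"
    by (rule prod.mono_neutral_left[OF assms(1) sub]) auto
  ultimately show ?thesis by (simp add: site_prod_def)
qed

text \<open>The columns of a vertical strip are counted by their lowest cells; these are the vertices with
  left label \<open>1\<close> that carry \<open>x\<close>, while all other cells carry \<open>x + 1\<close>.\<close>

lemma site_prod_wt:
  assumes lam: "is_partition lam" and mu: "mu \<in> vertical_strip_below lam"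
  shows "site_prod (\<lambda>j. wt x (lam j - mu j) (mc mu j) (lam (Suc j) - mu (Suc j)) (mc lam j))
    = strip_weight x lam mu"
proof -
  let ?f = "\<lambda>j. wt x (lam j - mu j) (mc mu j) (lam (Suc j) - mu (Suc j)) (mc lam j)"
  define A where "A = {j. lam j \<noteq> mu j}"
  \<comment> \<open>\<open>B\<close> collects the rows whose cell is the lowest one of its
    column.\<close>
  define B where "B = {j \<in> A. \<not> (Suc j \<in> A \<and> mu (Suc j) = mu j)}"
  have pmu: "is_partition mu" and le: "mu j \<le> lam j" "lam j \<le> Suc (mu j)" for j
    using mu by (auto simp: vertical_strip_below_def)
  have fin: "finite A" unfolding A_def using finite_skew_support[OF lam] le by blast
  have dec: "lam (Suc j) \<le> lam j" "mu (Suc j) \<le> mu j" for j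
    using is_partition_antimono[OF lam] is_partition_antimono[OF pmu] by auto
  have f1: "?f j = 1" if "j \<notin> A" for j
    using that le[of j] le[of "Suc j"] dec[of j] by (auto simp: A_def wt_def mc_def)
  have fB: "?f j = x" if "j \<in> B" for j
    using that le[of j] le[of "Suc j"] dec[of j] by (auto simp: A_def B_def wt_def mc_def)
  \<comment> \<open>Here both horizontal labels are \<open>1\<close> and \<open>mc mu j = 0\<close>,
    which is the exceptional vertex of weight \<open>x + 1\<close>.\<close>
  have fAB: "?f j = 1 + x" if "j \<in> A - B" for j
    using that le[of j] le[of "Suc j"] dec[of j] by (auto simp: A_def B_def wt_def mc_def)
  have inj: "inj_on mu B"
  proof (rule linorder_inj_onI)
    fix i j assume ij: "i < j" "i \<in> B" "j \<in> B"
    show "mu i \<noteq> mu j"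
    proof
      assume eq: "mu i = mu j"
      \<comment> \<open>Between two cells of the same column \<open>mu\<close> is constant and
        \<open>lam\<close> exceeds it, so row \<open>Suc i\<close> also has a cell there and
        \<open>i\<close> is not the lowest.\<close>
      have s: "mu (Suc i) = mu i"
        using is_partition_antimono[OF pmu, of "Suc i" j] dec[of i] eq ij by simp
      have "lam j = Suc (mu j)" using ij(3) le[of j] by (auto simp: B_def A_def)
      then have "lam (Suc i) \<noteq> mu (Suc i)"
        using is_partition_antimono[OF lam, of "Suc i" j] ij(1) s eq by simp
      then show False using ij(2) s by (simp add: B_def A_def)
    qed
  qed auto
  have "mu j \<in> mu ` B" if "j \<in> A" for j
  proof -
    \<comment> \<open>\<open>J\<close> holds the rows with a cell in column \<open>mu j\<close>; its
      maximum is the element of \<open>B\<close> for that column.\<close>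
    define J where "J = {i \<in> A. mu i = mu j}"
    have J: "finite J" "j \<in> J" using fin that by (auto simp: J_def)
    then have M: "Max J \<in> J" using Max_in by blast
    have "Suc (Max J) \<notin> J" using Max_ge[OF J(1)] not_less_eq_eq by blast
    then have "Max J \<in> B" using M by (auto simp: J_def B_def)
    then show ?thesis using M by (auto simp: J_def intro!: rev_image_eqI)
  qed
  then have "mu ` A = mu ` B" by (auto simp: B_def)
  then have card_B: "card B = card (mu ` A)" using card_image[OF inj] by simp
  have sub: "B \<subseteq> A" by (auto simp: B_def)
  have "site_prod ?f = prod ?f A" by (rule site_prod_eq_prod[OF fin f1])
  also have "\<dots> = prod ?f (A - B) * prod ?f B" by (rule prod.subset_diff[OF sub fin])
  also have "\<dots> = (1 + x) ^ card (A - B) * x ^ card B" using fB fAB by simp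
  also have "card (A - B) = card A - card B" using sub fin by (simp add: card_Diff_subset finite_subset)
  finally show ?thesis by (simp add: strip_weight_def card_B A_def mult.commute)
qed

section \<open>Conservative labelings\<close>

text \<open>This set does not depend on the parameters, unlike the set of labelings of nonzero
  weight, and can therefore be enumerated row by row.\<close>

definition conservative_labelings ::
    "nat \<Rightarrow> (nat \<Rightarrow> nat) \<Rightarrow> ((nat \<Rightarrow> nat \<Rightarrow> nat) \<times> (nat \<Rightarrow> nat \<Rightarrow> nat)) set" where
  "conservative_labelings n lam = {(v, h) \<in> labelings n (\<lambda>_. 0) (mc lam) 0.
     \<forall>k<n. \<forall>j. h k j + v k j = h k (Suc j) + v (Suc k) j}"

lemma wt_conservative: "wt x a b c d \<noteq> 0 \<Longrightarrow> a + b = c + d"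
  by (auto simp: wt_def split: if_splits)

text \<open>If infinitely many factors differ from \<open>1\<close>, the default value is already
  \<open>0\<close>; otherwise \<open>j\<close> is among the factors because
  \<open>0 \<noteq> 1\<close>.\<close>

lemma site_prod_zero:
  assumes "f j = 0"
  shows "site_prod f = (0::'a::comm_ring_1)"
  using assms by (auto simp: site_prod_def intro!: prod_zero bexI[of _ j])

lemma nonzero_labeling_conservative:
  assumes "L \<in> labelings n (\<lambda>_. 0) (mc lam) 0" "labeling_weight wt x n L \<noteq> 0"
  shows "L \<in> conservative_labelings n lam"
proof -
  obtain v h where L: "L = (v, h)" by force
  have "h k j + v k j = h k (Suc j) + v (Suc k) j" if "k < n" for k j
  proof (rule wt_conservative[where x = "x k"], rule notI)
    assume "wt (x k) (h k j) (v k j) (h k (Suc j)) (v (Suc k) j) = 0"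
    then have "labeling_weight wt x n L = 0"
      unfolding L labeling_weight_def using that by (auto intro!: prod_zero bexI[of _ k] site_prod_zero)
    then show False using assms(2) by simp
  qed
  then show ?thesis using assms(1) L by (simp add: conservative_labelings_def)
qed

text \<open>Vanishing differences make \<open>lam\<close> constant, and it is eventually zero. This
  settles the lattice without rows, where bottom and top boundary coincide.\<close>

lemma mc_eq_zero_iff:
  assumes "is_partition lam"
  shows "mc lam = (\<lambda>_. 0) \<longleftrightarrow> lam = (\<lambda>_. 0)"
proof
  assume "mc lam = (\<lambda>_. 0)"
  then have "lam j \<le> lam (Suc j)" for j by (simp add: mc_def fun_eq_iff)
  then have mono: "lam i \<le> lam j" if "i \<le> j" for i j using that by (rule lift_Suc_mono_le)
  obtain N where "\<forall>j\<ge>N. lam j = 0" using is_partition_eventually_zero[OF assms] ..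
  then have "lam i = 0" for i using mono[of i "max i N"] by simp
  then show "lam = (\<lambda>_. 0)" by auto
qed (auto simp: mc_def)

lemma conservative_labelings_0:
  assumes "is_partition lam"
  shows "conservative_labelings 0 lam =
    (if lam = (\<lambda>_. 0) then {(\<lambda>k. if k = 0 then (\<lambda>_. 0) else undefined, \<lambda>_. undefined)} else {})"
  using mc_eq_zero_iff[OF assms]
  by (auto simp: conservative_labelings_def labelings_def extensional_def fun_eq_iff)

text \<open>Conservation telescopes from the right end of a lattice row, which identifies the label to the
  left of site \<open>j\<close> with \<open>\<lambda>\<^sub>j - \<mu>\<^sub>j\<close>.\<close>

lemma conservative_row_partition:
  assumes lam: "is_partition lam" and h: "\<And>j. h j \<in> {0, 1}" "\<exists>N. \<forall>j\<ge>N. h j = 0"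
    and cons: "\<And>j. h j + u j = h (Suc j) + mc lam j"
  defines "mu \<equiv> \<lambda>j. lam j - h j"
  shows "mu \<in> vertical_strip_below lam" "mc mu = u" "\<And>j. lam j - mu j = h j"
proof -
  obtain N where N: "\<forall>j\<ge>N. lam j = 0" using is_partition_eventually_zero[OF lam] ..
  obtain M where M: "\<forall>j\<ge>M. h j = 0" using h(2) ..
  \<comment> \<open>Induction from the right end, where \<open>h\<close> vanishes; this keeps the
    subtraction in \<open>mu\<close> from truncating.\<close>
  have le: "h j \<le> lam j" for j
  proof (cases "j \<le> M")
    case True
    then show ?thesis
    proof (induction rule: inc_induct)
      case (step j)
      then show ?case
        using cons[of j] is_partition_antimono[OF lam, of j "Suc j"] by (simp add: mc_def)
    qed (simp add: M)
  qed (simp add: M)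
  have mu: "mu j + h j = lam j" for j using le[of j] by (simp add: mu_def)
  \<comment> \<open>Conservation rewritten in terms of \<open>mu\<close>; as \<open>u j\<close> is a
    natural number, \<open>mu\<close> decreases.\<close>
  have step: "mu j = mu (Suc j) + u j" for j
    using mu[of j] mu[of "Suc j"] cons[of j] is_partition_antimono[OF lam, of j "Suc j"]
    by (simp add: mc_def)
  have "is_partition mu"
  proof (rule is_partitionI[where N = N])
    show "mu (Suc j) \<le> mu j" for j using step[of j] by linarith
    show "mu j = 0" if "N \<le> j" for j using N that by (simp add: mu_def)
  qed
  moreover have "mu j \<le> lam j \<and> lam j \<le> Suc (mu j)" for j
    using mu[of j] h(1)[of j] by auto
  ultimately show "mu \<in> vertical_strip_below lam" by (simp add: vertical_strip_below_def)
  show "mc mu = u"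
  proof
    show "mc mu j = u j" for j using step[of j] by (simp add: mc_def)
  qed
  show "lam j - mu j = h j" for j using mu[of j] by simp
qed

section \<open>Adding and removing the top lattice row\<close>

definition add_row ::
    "nat \<Rightarrow> (nat \<Rightarrow> nat) \<Rightarrow> (nat \<Rightarrow> nat) \<times> (nat \<Rightarrow> nat \<Rightarrow> nat) \<times> (nat \<Rightarrow> nat \<Rightarrow> nat) \<Rightarrow>
     (nat \<Rightarrow> nat \<Rightarrow> nat) \<times> (nat \<Rightarrow> nat \<Rightarrow> nat)" where
  "add_row n lam = (\<lambda>(mu, v, h). (v(Suc n := mc lam), h(n := \<lambda>j. lam j - mu j)))"

text \<open>Resetting the dropped level and row to \<open>undefined\<close> restores the
  extensionality required of labelings of \<open>n\<close> rows.\<close>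

definition remove_row ::
    "nat \<Rightarrow> (nat \<Rightarrow> nat) \<Rightarrow> (nat \<Rightarrow> nat \<Rightarrow> nat) \<times> (nat \<Rightarrow> nat \<Rightarrow> nat) \<Rightarrow>
     (nat \<Rightarrow> nat) \<times> (nat \<Rightarrow> nat \<Rightarrow> nat) \<times> (nat \<Rightarrow> nat \<Rightarrow> nat)" where
  "remove_row n lam = (\<lambda>(v, h). (\<lambda>j. lam j - h n j, v(Suc n := undefined), h(n := undefined)))"

text \<open>The top row determines \<open>mu\<close> through its horizontal labels, and its bottom
  labels are then \<open>mc mu\<close>, so the remaining rows form a conservative labeling for
  \<open>mu\<close>.\<close>

lemma bij_betw_add_row:
  assumes lam: "is_partition lam"
  shows "bij_betw (add_row n lam)
    (SIGMA mu:vertical_strip_below lam. conservative_labelings n mu)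
    (conservative_labelings (Suc n) lam)"
proof (rule bij_betwI[where g = "remove_row n lam"])
  show "add_row n lam \<in> (SIGMA mu:vertical_strip_below lam. conservative_labelings n mu)
      \<rightarrow> conservative_labelings (Suc n) lam"
  proof
    fix p assume "p \<in> (SIGMA mu:vertical_strip_below lam. conservative_labelings n mu)"
    then obtain mu v h where p: "p = (mu, v, h)" and mu: "mu \<in> vertical_strip_below lam"
      and L: "(v, h) \<in> conservative_labelings n mu" by auto
    have le: "mu j \<le> lam j" "lam j \<le> Suc (mu j)" for j
      using mu by (auto simp: vertical_strip_below_def)
    have pmu: "is_partition mu" using mu by (simp add: vertical_strip_below_def)
    have dec: "lam (Suc j) \<le> lam j" "mu (Suc j) \<le> mu j" for j
      using is_partition_antimono[OF lam] is_partition_antimono[OF pmu] by auto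
    have "lam j - mu j + mc mu j = lam (Suc j) - mu (Suc j) + mc lam j" for j
      using le[of j] le[of "Suc j"] dec[of j] by (simp add: mc_def)
    moreover have "\<exists>N. \<forall>j\<ge>N. lam j - mu j = 0"
      using is_partition_eventually_zero[OF lam] by (metis diff_0_eq_0)
    moreover have "lam j - mu j \<in> {0, 1}" for j using le[of j] by auto
    ultimately show "add_row n lam p \<in> conservative_labelings (Suc n) lam"
      using L unfolding p
      by (auto simp: add_row_def conservative_labelings_def labelings_def less_Suc_eq
        extensional_def)
  qed
  have remove: "remove_row n lam L \<in> (SIGMA mu:vertical_strip_below lam. conservative_labelings n mu)
      \<and> add_row n lam (remove_row n lam L) = L"
    if "L \<in> conservative_labelings (Suc n) lam" for L
  proof -
    obtain v h where L: "L = (v, h)" by force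
    have vh: "v \<in> extensional {..Suc n}" "h \<in> extensional {..<Suc n}" "v 0 = (\<lambda>_. 0)"
      "v (Suc n) = mc lam" "\<And>k j. k \<le> n \<Longrightarrow> h k j \<in> {0, 1}" "\<And>k. k \<le> n \<Longrightarrow> \<exists>N. \<forall>j\<ge>N. h k j = 0"
      "\<And>k j. k \<le> n \<Longrightarrow> h k j + v k j = h k (Suc j) + v (Suc k) j"
      using that unfolding L conservative_labelings_def labelings_def by (auto simp: less_Suc_eq_le)
    define mu where "mu = (\<lambda>j. lam j - h n j)"
    have top: "h n j + v n j = h n (Suc j) + mc lam j" for j using vh(4) vh(7)[of n j] by simp
    have mu: "mu \<in> vertical_strip_below lam" "mc mu = v n" "\<And>j. lam j - mu j = h n j"
      using conservative_row_partition[of lam "h n" "v n", OF lam vh(5)[OF order_refl]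
        vh(6)[OF order_refl] top] by (simp_all add: mu_def)
    have "(v(Suc n := undefined), h(n := undefined)) \<in> conservative_labelings n mu"
      using vh unfolding conservative_labelings_def labelings_def mu(2)
      by (auto simp: extensional_def)
    then show ?thesis
      using mu vh(4) unfolding L by (auto simp: remove_row_def add_row_def mu_def fun_eq_iff)
  qed
  show "remove_row n lam \<in> conservative_labelings (Suc n) lam
      \<rightarrow> (SIGMA mu:vertical_strip_below lam. conservative_labelings n mu)"
    using remove by blast
  show "add_row n lam (remove_row n lam L) = L" if "L \<in> conservative_labelings (Suc n) lam" for L
    using remove that by blast
  show "remove_row n lam (add_row n lam p) = p"
    if asm: "p \<in> (SIGMA mu:vertical_strip_below lam. conservative_labelings n mu)" for p
  proof -
    obtain mu v h where p: "p = (mu, v, h)" and mu: "mu \<in> vertical_strip_below lam"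
      and L: "(v, h) \<in> conservative_labelings n mu" using asm by auto
    have "v (Suc n) = undefined" "h n = undefined"
      using L by (auto simp: conservative_labelings_def labelings_def extensional_def)
    moreover have "mu j \<le> lam j" for j using mu by (auto simp: vertical_strip_below_def)
    ultimately show ?thesis unfolding p by (auto simp: add_row_def remove_row_def fun_eq_iff)
  qed
qed

section \<open>The recursion for the partition function\<close>

lemma finite_conservative_labelings:
  "is_partition lam \<Longrightarrow> finite (conservative_labelings n lam)"
proof (induction n arbitrary: lam)
  case 0
  then show ?case by (simp add: conservative_labelings_0)
next
  case (Suc n)
  have "finite (SIGMA mu:vertical_strip_below lam. conservative_labelings n mu)"
    using Suc finite_vertical_strip_below by (auto simp: vertical_strip_below_def)
  then show ?case using bij_betw_finite[OF bij_betw_add_row[OF Suc.prems]] by blast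
qed

text \<open>Every labeling of nonzero weight is conservative, and the conservative ones added to the
  finite sum contribute \<open>0\<close>.\<close>

lemma Z_eq_sum_conservative:
  assumes "is_partition lam"
  shows "Z x n lam = (\<Sum>L\<in>conservative_labelings n lam. labeling_weight wt x n L)"
  unfolding Z_def partition_function_def
proof (rule sum.mono_neutral_left)
  show "{L \<in> labelings n (\<lambda>_. 0) (mc lam) 0. labeling_weight wt x n L \<noteq> 0} \<subseteq> conservative_labelings n lam"
    using nonzero_labeling_conservative by blast
  show "finite (conservative_labelings n lam)" by (rule finite_conservative_labelings[OF assms])
qed (auto simp: conservative_labelings_def)

lemma labeling_weight_add_row:
  assumes lam: "is_partition lam" and mu: "mu \<in> vertical_strip_below lam"
    and L: "L \<in> conservative_labelings n mu"
  shows "labeling_weight wt x (Suc n) (add_row n lam (mu, L)) =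
    labeling_weight wt x n L * strip_weight (x n) lam mu"
proof -
  obtain v h where vh: "L = (v, h)" by force
  have "v n = mc mu" using L by (auto simp: vh conservative_labelings_def labelings_def)
  then show ?thesis
    unfolding vh by (simp add: labeling_weight_def add_row_def site_prod_wt[OF lam mu])
qed

lemma Z_Suc:
  assumes lam: "is_partition lam"
  shows "Z x (Suc n) lam = (\<Sum>mu\<in>vertical_strip_below lam. Z x n mu * strip_weight (x n) lam mu)"
proof -
  have pmu: "is_partition mu" if "mu \<in> vertical_strip_below lam" for mu
    using that by (simp add: vertical_strip_below_def)
  have "Z x (Suc n) lam =
      (\<Sum>p\<in>(SIGMA mu:vertical_strip_below lam. conservative_labelings n mu).
        labeling_weight wt x (Suc n) (add_row n lam p))"
    unfolding Z_eq_sum_conservative[OF lam]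
    by (rule sum.reindex_bij_betw[OF bij_betw_add_row[OF lam], symmetric])
  also have "\<dots> = (\<Sum>mu\<in>vertical_strip_below lam. \<Sum>L\<in>conservative_labelings n mu.
        labeling_weight wt x (Suc n) (add_row n lam (mu, L)))"
    by (subst sum.Sigma)
      (auto simp: finite_vertical_strip_below[OF lam] finite_conservative_labelings pmu)
  also have "\<dots> = (\<Sum>mu\<in>vertical_strip_below lam. \<Sum>L\<in>conservative_labelings n mu.
        labeling_weight wt x n L * strip_weight (x n) lam mu)"
    by (intro sum.cong refl labeling_weight_add_row[OF lam])
  also have "\<dots> = (\<Sum>mu\<in>vertical_strip_below lam. Z x n mu * strip_weight (x n) lam mu)"
    by (intro sum.cong refl) (simp add: Z_eq_sum_conservative pmu sum_distrib_right)
  finally show ?thesis .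
qed

lemma weak_dual_groth_eq_Z:
  "is_partition lam \<Longrightarrow> weak_dual_groth x n lam = Z x n lam"
proof (induction n arbitrary: lam)
  case 0
  have "conjugate (\<lambda>_. 0) = (\<lambda>_. 0)" by (auto simp: conjugate_def)
  \<comment> \<open>The base case of \<open>dual_groth\<close> tests \<open>conjugate lam\<close>,
    while that of the lattice tests \<open>lam\<close>.\<close>
  then have "conjugate lam = (\<lambda>_. 0) \<longleftrightarrow> lam = (\<lambda>_. 0)"
    using conjugate_conjugate[OF 0] by metis
  then show ?case
    by (simp add: weak_dual_groth_def Z_eq_sum_conservative[OF 0] conservative_labelings_0[OF 0]
      labeling_weight_def)
next
  case (Suc n)
  then show ?case
    by (simp add: weak_dual_groth_Suc Z_Suc) (simp add: vertical_strip_below_def)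
qed

section \<open>Duality of the two models\<close>

text \<open>The vertex is turned upside down and its horizontal labels are complemented; for labels
  in \<open>{0, 1}\<close> the subtraction \<open>1 - a\<close> is a true complement.\<close>

lemma wt_star_eq_wt:
  "a \<in> {0, 1} \<Longrightarrow> c \<in> {0, 1} \<Longrightarrow> wt_star x a b c d = wt x (1 - a) d (1 - c) b"
  by (auto simp: wt_def wt_star_def)

text \<open>There are \<open>n + 1\<close> levels of vertical edges but \<open>n\<close> rows, hence
  the reflections \<open>n - k\<close> and \<open>n - 1 - k\<close>. Sites keep their order, so the
  right boundary stays on the right.\<close>

definition flip_labeling ::
    "nat \<Rightarrow> (nat \<Rightarrow> nat \<Rightarrow> nat) \<times> (nat \<Rightarrow> nat \<Rightarrow> nat) \<Rightarrow> (nat \<Rightarrow> nat \<Rightarrow> nat) \<times> (nat \<Rightarrow> nat \<Rightarrow> nat)" where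
  "flip_labeling n = (\<lambda>(v, h). (restrict (\<lambda>k. v (n - k)) {..n},
     restrict (\<lambda>k j. 1 - h (n - 1 - k) j) {..<n}))"

lemma flip_labeling_in_labelings:
  assumes "L \<in> labelings n lower upper r"
  shows "flip_labeling n L \<in> labelings n upper lower (1 - r)"
proof -
  obtain v h where L: "L = (v, h)" by force
  have "\<exists>N. \<forall>j\<ge>N. 1 - h (n - 1 - k) j = 1 - r" if "k < n" for k
  proof -
    have "\<exists>N. \<forall>j\<ge>N. h (n - 1 - k) j = r" using assms that by (auto simp: L labelings_def)
    then show ?thesis by auto
  qed
  then show ?thesis using assms by (auto simp: L labelings_def flip_labeling_def)
qed

lemma flip_labeling_flip_labeling:
  assumes "L \<in> labelings n lower upper r"
  shows "flip_labeling n (flip_labeling n L) = L"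
proof -
  obtain v h where L: "L = (v, h)" by force
  have v: "v \<in> extensional {..n}" and h: "h \<in> extensional {..<n}"
    and bin: "k < n \<Longrightarrow> h k j \<in> {0, 1}" for k j
    using assms by (auto simp: L labelings_def)
  have "restrict (\<lambda>k. restrict (\<lambda>k. v (n - k)) {..n} (n - k)) {..n} = v"
    by (rule extensionalityI[OF _ v]) auto
  moreover have "restrict (\<lambda>k j. 1 - restrict (\<lambda>k j. 1 - h (n - 1 - k) j) {..<n} (n - 1 - k) j) {..<n} = h"
  proof (rule extensionalityI[OF _ h])
    fix k assume "k \<in> {..<n}"
    moreover from this have "1 - (1 - h k j) = h k j" for j using bin[of k j] by auto
    ultimately show "restrict (\<lambda>k j. 1 - restrict (\<lambda>k j. 1 - h (n - 1 - k) j) {..<n} (n - 1 - k) j) {..<n} k = h k"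
      by (auto simp: fun_eq_iff)
  qed simp
  ultimately show ?thesis unfolding L flip_labeling_def by simp
qed

lemma labeling_weight_flip_labeling:
  assumes "L \<in> labelings n lower upper r"
  shows "labeling_weight wt_star (\<lambda>k. x (n - 1 - k)) n (flip_labeling n L) = labeling_weight wt x n L"
proof -
  obtain v h where L: "L = (v, h)" by force
  have bin: "h k j = 0 \<or> h k j = 1" if "k < n" for k j
    using assms that by (auto simp: L labelings_def)
  define row where "row = (\<lambda>k. site_prod (\<lambda>j. wt (x k) (h k j) (v k j) (h k (Suc j)) (v (Suc k) j)))"
  have "labeling_weight wt_star (\<lambda>k. x (n - 1 - k)) n (flip_labeling n L) = (\<Prod>k<n. row (n - Suc k))"
    unfolding labeling_weight_def L flip_labeling_def prod.case row_def
  proof (intro prod.cong refl arg_cong[where f = site_prod] ext)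
    fix k j assume "k \<in> {..<n}"
    \<comment> \<open>The last equation identifies the bottom level \<open>n - k\<close> of the
      flipped row with the top level of the original row \<open>n - Suc k\<close>.\<close>
    then have k: "k < n" "n - Suc k < n" "Suc (n - Suc k) = n - k" by auto
    have "wt_star y (1 - h (n - Suc k) j) b (1 - h (n - Suc k) (Suc j)) d
        = wt y (h (n - Suc k) j) d (h (n - Suc k) (Suc j)) b" for y b d
      using bin[OF k(2), of j] bin[OF k(2), of "Suc j"] by (auto simp: wt_star_eq_wt)
    then show "wt_star (x (n - 1 - k)) (restrict (\<lambda>k j. 1 - h (n - 1 - k) j) {..<n} k j)
        (restrict (\<lambda>k. v (n - k)) {..n} k j) (restrict (\<lambda>k j. 1 - h (n - 1 - k) j) {..<n} k (Suc j))
        (restrict (\<lambda>k. v (n - k)) {..n} (Suc k) j) =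
      wt (x (n - Suc k)) (h (n - Suc k) j) (v (n - Suc k) j) (h (n - Suc k) (Suc j))
        (v (Suc (n - Suc k)) j)"
      using k by simp
  qed
  also have "\<dots> = (\<Prod>k<n. row k)" by (rule prod.nat_diff_reindex)
  finally show ?thesis by (simp add: L labeling_weight_def row_def)
qed

text \<open>Flipping preserves weights and is its own inverse, so it matches the labelings of
  nonzero weight in the two models.\<close>

lemma Z_eq_Z_star: "Z x n lam = Z_star x n lam"
proof -
  let ?A = "{L \<in> labelings n (\<lambda>_. 0) (mc lam) 0. labeling_weight wt x n L \<noteq> 0}"
  let ?w = "labeling_weight wt_star (\<lambda>k. x (n - 1 - k)) n"
  let ?B = "{L \<in> labelings n (mc lam) (\<lambda>_. 0) 1. ?w L \<noteq> 0}"
  have flip_back: "flip_labeling n L \<in> labelings n (\<lambda>_. 0) (mc lam) 0"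
    if "L \<in> labelings n (mc lam) (\<lambda>_. 0) 1" for L
    using flip_labeling_in_labelings[OF that] by simp
  have weight: "labeling_weight wt x n (flip_labeling n L) = ?w L"
    if "L \<in> labelings n (mc lam) (\<lambda>_. 0) 1" for L
    using labeling_weight_flip_labeling[OF flip_back[OF that], of x] flip_labeling_flip_labeling[OF that]
    by simp
  have "bij_betw (flip_labeling n) ?A ?B"
  proof (rule bij_betwI[where g = "flip_labeling n"])
    show "flip_labeling n \<in> ?A \<rightarrow> ?B"
    proof
      fix L assume L: "L \<in> ?A"
      then have "L \<in> labelings n (\<lambda>_. 0) (mc lam) 0" by simp
      from flip_labeling_in_labelings[OF this] labeling_weight_flip_labeling[OF this, of x] L
      show "flip_labeling n L \<in> ?B" by simp
    qed
    show "flip_labeling n \<in> ?B \<rightarrow> ?A" using flip_back weight by auto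
  qed (auto simp: flip_labeling_flip_labeling)
  then have "(\<Sum>L\<in>?A. ?w (flip_labeling n L)) = sum ?w ?B" by (rule sum.reindex_bij_betw)
  moreover have "?w (flip_labeling n L) = labeling_weight wt x n L" if "L \<in> ?A" for L
    using that by (blast intro: labeling_weight_flip_labeling)
  ultimately show ?thesis by (simp only: Z_def Z_star_def partition_function_def cong: sum.cong)
qed

theorem theorem3p3:
  fixes x :: "nat \<Rightarrow> 'a::comm_ring_1" and n :: nat and lam :: "nat \<Rightarrow> nat"
  assumes "n \<ge> 1" and "is_partition lam"
  shows "weak_dual_groth x n lam = Z x n lam \<and> Z x n lam = Z_star x n lam"
  using weak_dual_groth_eq_Z[OF assms(2)] Z_eq_Z_star by blast

end
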